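(* The social choice function $f:\Theta\rightarrow X$ is strongly implementable if and only if there exists a payment scheme $P:\Theta\rightarrow\mathbb{Q}^n$ such that the direct revelation mechanism $\Gamma_{(f,P)}$ is incentive compatible and satisfies the selective elimination condition.
   Context: There are $n$ agents $N=\{1,\dots,n\}$ and a finite set $X$ of social choices. Each agent $i$ has a finite type set $\Theta_i$; $\Theta=\Theta_1\times\dots\times\Theta_n$, $\Theta_{-i}=\prod_{j\neq i}\Theta_j$, and $\theta=(\theta_{-i},\theta_i)$. There is a probability distribution $p:\Theta\rightarrow\mathbb{Q}$ ($p\ge0$, $\sum_\theta p(\theta)=1$) with strictly positive marginals $p_i(\theta_i)=\sum_{\theta_{-i}}p(\theta_{-i},\theta_i)$; beliefs are $q_i(\theta_{-i}\mid\theta_i)=p(\theta_{-i},\theta_i)/p_i(\theta_i)$. Each agent has a valuation function $V_i:X\times\Theta\rightarrow\mathbb{Q}$. A social choice function is $f:\Theta\rightarrow X$. A mechanism $\Gamma=(S_1,\dots,S_n,g,P)$ consists of bid sets $S_i$, an outcome function $g:S\rightarrow X$ and payments $P=(P_1,\dots,P_n):S\rightarrow\mathbb{Q}^n$, $S=\prod_i S_i$. A strategy is $\alpha_i:\Theta_i\rightarrow S_i$, a profile is $\alpha=(\alpha_1,\dots,\alpha_n)$, $\alpha(\theta)=(\alpha_i(\theta_i))_i$. Expected utility: $U^\Gamma_i(\alpha_{-i},s_i\mid\theta_i)=\sum_{\theta_{-i}}q_i(\theta_{-i}\mid\theta_i)\big(V_i(g(\alpha_{-i}(\theta_{-i}),s_i),\theta)+P_i(\alpha_{-i}(\theta_{-i}),s_i)\big)$.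 $\alpha$ is an equilibrium if $\alpha_i(\theta_i)$ maximizes $U^\Gamma_i(\alpha_{-i},\cdot\mid\theta_i)$ over $S_i$ for all $i,\theta_i$. $\Gamma$ strongly implements $f$ if it has an equilibrium and every equilibrium $\alpha$ has $g\circ\alpha=f$; $f$ is strongly implementable if some mechanism strongly implements it. The direct revelation mechanism $\Gamma_{(f,P)}$ is $(\Theta_1,\dots,\Theta_n,f,P)$ with $P:\Theta\rightarrow\mathbb{Q}^n$; it is incentive compatible if truthful reporting ($\alpha_i=\mathrm{id}_{\Theta_i}$ for all $i$) is an equilibrium. An equilibrium $\alpha$ of $\Gamma_{(f,P)}$ is bad if $f\circ\alpha\neq f$. An equilibrium $\alpha$ of $\Gamma_{(f,P)}$ can be selectively eliminated if there exist an agent $i$ and functions $h:\Theta_{-i}\rightarrow X$, $\bar P_i:\Theta_{-i}\rightarrow\mathbb{Q}$ such that (1) for some $\bar\theta_i\in\Theta_i$: $\sum_{\theta_{-i}}q_i(\theta_{-i}\mid\bar\theta_i)\big(V_i(h(\alpha_{-i}(\theta_{-i})),\theta_{-i},\bar\theta_i)+\bar P_i(\alpha_{-i}(\theta_{-i}))\big)>\sum_{\theta_{-i}}q_i(\theta_{-i}\mid\bar\theta_i)\big(V_i(f(\alpha_{-i}(\theta_{-i}),\alpha_i(\bar\theta_i)),\theta_{-i},\bar\theta_i)+P_i(\alpha_{-i}(\theta_{-i}),\alpha_i(\bar\theta_i))\big)$, and (2) for all $\theta_i\in\Theta_i$: $\sum_{\theta_{-i}}q_i(\theta_{-i}\mid\theta_i)\big(V_i(f(\theta),\theta)+P_i(\theta)-V_i(h(\theta_{-i}),\theta)-\bar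 P_i(\theta_{-i})\big)\ge0$. $\Gamma_{(f,P)}$ satisfies the selective elimination condition if every bad equilibrium of it can be selectively eliminated. *)

theory Defs
  imports Complex_Main "HOL-Library.FuncSet" "HOL-Library.Infinite_Typeclass"
begin

text \<open>
  The type sets \<open>\<Theta>\<^sub>i\<close> are subsets of one common HOL type \<open>'t\<close>, the bid sets \<open>S\<^sub>i\<close> are
  subsets of one common HOL type \<open>'s\<close>.  Elements of \<open>\<Theta>\<close>, \<open>S\<close> and \<open>\<Theta>\<^sub>-\<^sub>i\<close> are
  extensional functions (\<^const>\<open>PiE\<close>) on the agents, respectively on all agents but \<open>i\<close>, so
  that summation over them is correct; \<open>(\<theta>\<^sub>-\<^sub>i, \<theta>\<^sub>i)\<close> is the function update
  \<open>\<theta>'(i := \<theta>\<^sub>i)\<close> of \<open>\<theta>' \<in> \<Theta>\<^sub>-\<^sub>i\<close>.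
\<close>

record ('t, 'x) environment =
  num_agents :: nat
  choices :: "'x set"
  types :: "nat \<Rightarrow> 't set"
  prior :: "(nat \<Rightarrow> 't) \<Rightarrow> rat"
  valuation :: "nat \<Rightarrow> 'x \<Rightarrow> (nat \<Rightarrow> 't) \<Rightarrow> rat"

definition agents :: "('t, 'x) environment \<Rightarrow> nat set" where
  "agents E = {1..num_agents E}"

definition type_profiles :: "('t, 'x) environment \<Rightarrow> (nat \<Rightarrow> 't) set" where
  "type_profiles E = PiE (agents E) (types E)"

definition other_types :: "('t, 'x) environment \<Rightarrow> nat \<Rightarrow> (nat \<Rightarrow> 't) set" where
  "other_types E i = PiE (agents E - {i}) (types E)"

definition marginal :: "('t, 'x) environment \<Rightarrow> nat \<Rightarrow> 't \<Rightarrow> rat" where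
  "marginal E i t = (\<Sum>\<theta>'\<in>other_types E i. prior E (\<theta>'(i := t)))"

definition belief :: "('t, 'x) environment \<Rightarrow> nat \<Rightarrow> (nat \<Rightarrow> 't) \<Rightarrow> 't \<Rightarrow> rat" where
  "belief E i \<theta>' t = prior E (\<theta>'(i := t)) / marginal E i t"

definition bayesian_environment :: "('t, 'x) environment \<Rightarrow> bool" where
  "bayesian_environment E \<longleftrightarrow>
     finite (choices E) \<and>
     (\<forall>i\<in>agents E. finite (types E i)) \<and>
     (\<forall>\<theta>\<in>type_profiles E. prior E \<theta> \<ge> 0) \<and>
     (\<Sum>\<theta>\<in>type_profiles E. prior E \<theta>) = 1 \<and>
     (\<forall>i\<in>agents E. \<forall>t\<in>types E i. marginal E i t > 0)"

definition social_choice_function ::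
    "('t, 'x) environment \<Rightarrow> ((nat \<Rightarrow> 't) \<Rightarrow> 'x) \<Rightarrow> bool" where
  "social_choice_function E f \<longleftrightarrow> f \<in> type_profiles E \<rightarrow> choices E"

record ('s, 'x) mechanism =
  bids :: "nat \<Rightarrow> 's set"
  outcome :: "(nat \<Rightarrow> 's) \<Rightarrow> 'x"
  payment :: "nat \<Rightarrow> (nat \<Rightarrow> 's) \<Rightarrow> rat"

text \<open>Bid sets need not be finite.\<close>

definition is_mechanism :: "('t, 'x) environment \<Rightarrow> ('s, 'x) mechanism \<Rightarrow> bool" where
  "is_mechanism E \<Gamma> \<longleftrightarrow> outcome \<Gamma> \<in> PiE (agents E) (bids \<Gamma>) \<rightarrow> choices E"

definition strategy_profile ::
    "('t, 'x) environment \<Rightarrow> ('s, 'x) mechanism \<Rightarrow> (nat \<Rightarrow> 't \<Rightarrow> 's) \<Rightarrow> bool" where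
  "strategy_profile E \<Gamma> \<alpha> \<longleftrightarrow> (\<forall>i\<in>agents E. \<alpha> i \<in> types E i \<rightarrow> bids \<Gamma> i)"

text \<open>
  \<open>play A \<alpha> \<theta>\<close> is \<open>\<alpha>(\<theta>)\<close> for \<open>A\<close> the set of all agents, and \<open>\<alpha>\<^sub>-\<^sub>i(\<theta>\<^sub>-\<^sub>i)\<close> for \<open>A\<close> the set
  of all agents but \<open>i\<close>.
\<close>

definition play :: "nat set \<Rightarrow> (nat \<Rightarrow> 't \<Rightarrow> 's) \<Rightarrow> (nat \<Rightarrow> 't) \<Rightarrow> nat \<Rightarrow> 's" where
  "play A \<alpha> \<theta> = (\<lambda>j\<in>A. \<alpha> j (\<theta> j))"

definition expected_utility ::
    "('t, 'x) environment \<Rightarrow> ('s, 'x) mechanism \<Rightarrow> nat \<Rightarrow> (nat \<Rightarrow> 't \<Rightarrow> 's) \<Rightarrow> 's \<Rightarrow> 't \<Rightarrow> rat" where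
  "expected_utility E \<Gamma> i \<alpha> s t =
     (\<Sum>\<theta>'\<in>other_types E i. belief E i \<theta>' t *
        (valuation E i (outcome \<Gamma> ((play (agents E - {i}) \<alpha> \<theta>')(i := s))) (\<theta>'(i := t))
         + payment \<Gamma> i ((play (agents E - {i}) \<alpha> \<theta>')(i := s))))"

definition equilibrium ::
    "('t, 'x) environment \<Rightarrow> ('s, 'x) mechanism \<Rightarrow> (nat \<Rightarrow> 't \<Rightarrow> 's) \<Rightarrow> bool" where
  "equilibrium E \<Gamma> \<alpha> \<longleftrightarrow>
     strategy_profile E \<Gamma> \<alpha> \<and>
     (\<forall>i\<in>agents E. \<forall>t\<in>types E i. \<forall>s\<in>bids \<Gamma> i.
        expected_utility E \<Gamma> i \<alpha> s t \<le> expected_utility E \<Gamma> i \<alpha> (\<alpha> i t) t)"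

definition strongly_implements ::
    "('t, 'x) environment \<Rightarrow> ('s, 'x) mechanism \<Rightarrow> ((nat \<Rightarrow> 't) \<Rightarrow> 'x) \<Rightarrow> bool" where
  "strongly_implements E \<Gamma> f \<longleftrightarrow>
     (\<exists>\<alpha>. equilibrium E \<Gamma> \<alpha>) \<and>
     (\<forall>\<alpha>. equilibrium E \<Gamma> \<alpha> \<longrightarrow>
        (\<forall>\<theta>\<in>type_profiles E. outcome \<Gamma> (play (agents E) \<alpha> \<theta>) = f \<theta>))"

text \<open>
  HOL cannot quantify existentially over types, so the type \<open>'s\<close> containing the bids is a
  parameter.  Any family of bid sets embeds into some infinite \<open>'s\<close>; a statement about
  \<open>strongly_implementable TYPE('s::infinite)\<close> with \<open>'s\<close> a type variable therefore
  covers mechanisms with arbitrary bid sets.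
\<close>

definition strongly_implementable ::
    "'s itself \<Rightarrow> ('t, 'x) environment \<Rightarrow> ((nat \<Rightarrow> 't) \<Rightarrow> 'x) \<Rightarrow> bool" where
  "strongly_implementable (_ :: 's itself) E f \<longleftrightarrow>
     (\<exists>\<Gamma> :: ('s, 'x) mechanism. is_mechanism E \<Gamma> \<and> strongly_implements E \<Gamma> f)"
  for E :: "('t, 'x) environment"

definition direct_mechanism ::
    "('t, 'x) environment \<Rightarrow> ((nat \<Rightarrow> 't) \<Rightarrow> 'x) \<Rightarrow> (nat \<Rightarrow> (nat \<Rightarrow> 't) \<Rightarrow> rat)
      \<Rightarrow> ('t, 'x) mechanism" where
  "direct_mechanism E f P = \<lparr>bids = types E, outcome = f, payment = P\<rparr>"

definition incentive_compatible ::
    "('t, 'x) environment \<Rightarrow> ((nat \<Rightarrow> 't) \<Rightarrow> 'x) \<Rightarrow> (nat \<Rightarrow> (nat \<Rightarrow> 't) \<Rightarrow> rat) \<Rightarrow> bool" where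
  "incentive_compatible E f P \<longleftrightarrow> equilibrium E (direct_mechanism E f P) (\<lambda>i. id)"

definition bad_equilibrium ::
    "('t, 'x) environment \<Rightarrow> ((nat \<Rightarrow> 't) \<Rightarrow> 'x) \<Rightarrow> (nat \<Rightarrow> (nat \<Rightarrow> 't) \<Rightarrow> rat)
      \<Rightarrow> (nat \<Rightarrow> 't \<Rightarrow> 't) \<Rightarrow> bool" where
  "bad_equilibrium E f P \<alpha> \<longleftrightarrow>
     equilibrium E (direct_mechanism E f P) \<alpha> \<and>
     (\<exists>\<theta>\<in>type_profiles E. f (play (agents E) \<alpha> \<theta>) \<noteq> f \<theta>)"

definition selectively_eliminable ::
    "('t, 'x) environment \<Rightarrow> ((nat \<Rightarrow> 't) \<Rightarrow> 'x) \<Rightarrow> (nat \<Rightarrow> (nat \<Rightarrow> 't) \<Rightarrow> rat)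
      \<Rightarrow> (nat \<Rightarrow> 't \<Rightarrow> 't) \<Rightarrow> bool" where
  "selectively_eliminable E f P \<alpha> \<longleftrightarrow>
     (\<exists>i\<in>agents E. \<exists>h \<in> other_types E i \<rightarrow> choices E. \<exists>Q :: (nat \<Rightarrow> 't) \<Rightarrow> rat.
        (\<exists>t\<in>types E i.
           (\<Sum>\<theta>'\<in>other_types E i. belief E i \<theta>' t *
              (valuation E i (h (play (agents E - {i}) \<alpha> \<theta>')) (\<theta>'(i := t))
               + Q (play (agents E - {i}) \<alpha> \<theta>')))
           > (\<Sum>\<theta>'\<in>other_types E i. belief E i \<theta>' t *
              (valuation E i (f ((play (agents E - {i}) \<alpha> \<theta>')(i := \<alpha> i t))) (\<theta>'(i := t))
               + P i ((play (agents E - {i}) \<alpha> \<theta>')(i := \<alpha> i t))))) \<and>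
        (\<forall>t\<in>types E i.
           (\<Sum>\<theta>'\<in>other_types E i. belief E i \<theta>' t *
              (valuation E i (f (\<theta>'(i := t))) (\<theta>'(i := t)) + P i (\<theta>'(i := t))
               - valuation E i (h \<theta>') (\<theta>'(i := t)) - Q \<theta>')) \<ge> 0))"
  for E :: "('t, 'x) environment"

definition selective_elimination_condition ::
    "('t, 'x) environment \<Rightarrow> ((nat \<Rightarrow> 't) \<Rightarrow> 'x) \<Rightarrow> (nat \<Rightarrow> (nat \<Rightarrow> 't) \<Rightarrow> rat) \<Rightarrow> bool" where
  "selective_elimination_condition E f P \<longleftrightarrow>
     (\<forall>\<alpha>. bad_equilibrium E f P \<alpha> \<longrightarrow> selectively_eliminable E f P \<alpha>)"

end

theory Submission
  imports Defs "HOL-Analysis.Finite_Cartesian_Product"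
begin

text \<open>
  If \<open>\<Gamma>\<close> strongly implements \<open>f\<close> with equilibrium \<open>\<alpha>\<close>, take the payments \<open>P\<close> along \<open>\<alpha>\<close>.  A bad
  equilibrium \<open>\<beta>\<close> of the direct mechanism yields a profile \<open>\<alpha> \<circ> \<beta>\<close> of \<open>\<Gamma>\<close> that is not an
  equilibrium, and the profitable deviation of some agent from it provides \<open>h\<close> and \<open>Q\<close>.

  Conversely, augment the direct mechanism by bids \<open>((h, Q), z)\<close>, where \<open>(h, Q)\<close> is an objection that
  does not pay against truthful agents and \<open>z\<close> is a natural number.  A single objector gets \<open>h\<close> and
  \<open>Q\<close> evaluated at the reports of the others, and every objector pays the fee \<open>1 / (z + 1)\<close>.  No
  objection is a best reply, since a larger \<open>z\<close> is better; so all equilibria consist of reports, and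
  the bad ones are destroyed by an objection with \<open>z\<close> large enough.
\<close>

subsection \<open>Utilities of composed strategies\<close>

lemma finite_other_types:
  "bayesian_environment E \<Longrightarrow> finite (other_types E i)"
  unfolding bayesian_environment_def other_types_def agents_def
  by (intro finite_PiE) auto

text \<open>Positive marginals make each belief a probability distribution, so a constant such as a
  fee can be pulled out of an expected utility.\<close>

lemma sum_belief:
  assumes "bayesian_environment E" "i \<in> agents E" "t \<in> types E i"
  shows "(\<Sum>\<theta>'\<in>other_types E i. belief E i \<theta>' t) = 1"
proof -
  have "marginal E i t \<noteq> 0"
    using assms unfolding bayesian_environment_def by (metis less_irrefl)
  then show ?thesis
    unfolding belief_def by (simp add: sum_divide_distrib[symmetric] marginal_def)
qed

lemma type_profiles_nonempty:
  "bayesian_environment E \<Longrightarrow> type_profiles E \<noteq> {}"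
  unfolding bayesian_environment_def by (metis sum.empty zero_neq_one)

lemma types_nonempty:
  "bayesian_environment E \<Longrightarrow> i \<in> agents E \<Longrightarrow> types E i \<noteq> {}"
  using type_profiles_nonempty[of E] unfolding type_profiles_def by (auto simp: PiE_eq_empty_iff)

lemma play_in_PiE:
  "(\<And>j. j \<in> A \<Longrightarrow> \<beta> j \<in> types E j \<rightarrow> B j) \<Longrightarrow> \<theta> \<in> PiE A (types E) \<Longrightarrow> play A \<beta> \<theta> \<in> PiE A B"
  unfolding play_def by (auto simp: PiE_mem)

lemma update_in_PiE:
  "i \<in> A \<Longrightarrow> \<theta>' \<in> PiE (A - {i}) B \<Longrightarrow> s \<in> B i \<Longrightarrow> \<theta>'(i := s) \<in> PiE A B"
  by (auto simp: PiE_iff extensional_def)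

lemma play_id: "\<theta> \<in> PiE A B \<Longrightarrow> play A (\<lambda>i. id) \<theta> = \<theta>"
  unfolding play_def by (auto simp: PiE_iff extensional_restrict)

lemma play_play: "play A \<alpha> (play A \<beta> \<theta>) = play A (\<lambda>j. \<alpha> j \<circ> \<beta> j) \<theta>"
  unfolding play_def by auto

text \<open>Unilateral deviations survive composition: a deviation to \<open>s\<close> from
  \<open>\<beta>\<close>, pushed through \<open>\<alpha>\<close>, is a deviation to
  \<open>\<alpha> i s\<close> from the composed profile. This serves the revelation argument, the
  relabelling of bids and the extraction of reports.\<close>

lemma play_update:
  "i \<in> A \<Longrightarrow> play A \<alpha> ((play (A - {i}) \<beta> \<theta>')(i := s)) =
     (play (A - {i}) (\<lambda>j. \<alpha> j \<circ> \<beta> j) \<theta>')(i := \<alpha> i s)"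
  unfolding play_def by auto

lemma play_cong:
  "(\<And>j t. j \<in> A \<Longrightarrow> t \<in> B j \<Longrightarrow> \<alpha> j t = \<beta> j t) \<Longrightarrow> \<theta> \<in> PiE A B \<Longrightarrow> play A \<alpha> \<theta> = play A \<beta> \<theta>"
  unfolding play_def by (auto simp: PiE_mem)

lemma expected_utility_cong:
  assumes "\<And>j t. j \<in> agents E \<Longrightarrow> t \<in> types E j \<Longrightarrow> \<alpha> j t = \<beta> j t"
  shows "expected_utility E \<Gamma> i \<alpha> s t = expected_utility E \<Gamma> i \<beta> s t"
proof -
  have "play (agents E - {i}) \<alpha> \<theta>' = play (agents E - {i}) \<beta> \<theta>'" if "\<theta>' \<in> other_types E i" for \<theta>'
    using play_cong[of "agents E - {i}" "types E" \<alpha> \<beta> \<theta>'] assms that unfolding other_types_def by auto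
  then show ?thesis
    unfolding expected_utility_def by simp
qed

text \<open>Strategies are total functions, but only their values at types of agents matter. Decoded
  or projected strategies, which are controlled only there, can thus replace the original
  ones.\<close>

lemma equilibrium_cong:
  assumes "\<And>j t. j \<in> agents E \<Longrightarrow> t \<in> types E j \<Longrightarrow> \<alpha> j t = \<beta> j t"
  shows "equilibrium E \<Gamma> \<alpha> \<longleftrightarrow> equilibrium E \<Gamma> \<beta>"
proof -
  have "strategy_profile E \<Gamma> \<alpha> \<longleftrightarrow> strategy_profile E \<Gamma> \<beta>"
    unfolding strategy_profile_def Pi_iff using assms by auto
  moreover have "expected_utility E \<Gamma> i \<alpha> s t = expected_utility E \<Gamma> i \<beta> s t" for i s t
    using assms by (rule expected_utility_cong)
  ultimately show ?thesis
    unfolding equilibrium_def using assms by simp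
qed

subsection \<open>Necessity\<close>

text \<open>This is the revelation principle at the level of utilities: reporting
  \<open>\<beta>\<close> in the direct mechanism amounts to playing \<open>\<alpha>\<close> after
  \<open>\<beta>\<close> in \<open>\<Gamma>\<close>. As \<open>f\<close> agrees with the outcome of
  \<open>\<alpha>\<close> only on type profiles, all reports have to be types.\<close>

lemma expected_utility_direct_mechanism:
  fixes \<alpha> :: "nat \<Rightarrow> 't \<Rightarrow> 's"
  assumes i: "i \<in> agents E" and s: "s \<in> types E i"
    and \<beta>: "\<And>j. j \<in> agents E \<Longrightarrow> \<beta> j \<in> types E j \<rightarrow> types E j"
    and f: "\<And>\<theta>. \<theta> \<in> type_profiles E \<Longrightarrow> f \<theta> = outcome \<Gamma> (play (agents E) \<alpha> \<theta>)"
  shows "expected_utility E (direct_mechanism E f (\<lambda>i \<theta>. payment \<Gamma> i (play (agents E) \<alpha> \<theta>))) i \<beta> s t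
    = expected_utility E \<Gamma> i (\<lambda>j. \<alpha> j \<circ> \<beta> j) (\<alpha> i s) t"
proof -
  have "(play (agents E - {i}) \<beta> \<theta>')(i := s) \<in> type_profiles E" if "\<theta>' \<in> other_types E i" for \<theta>'
    unfolding type_profiles_def
    using that \<beta> i s by (intro update_in_PiE play_in_PiE) (auto simp: other_types_def)
  then show ?thesis
    unfolding expected_utility_def direct_mechanism_def
    by (intro sum.cong) (simp_all add: f play_update[OF i])
qed

lemma strongly_implements_imp:
  assumes \<Gamma>: "is_mechanism E \<Gamma>" and si: "strongly_implements E \<Gamma> f"
  shows "\<exists>P. incentive_compatible E f P \<and> selective_elimination_condition E f P"
proof -
  obtain \<alpha> where \<alpha>: "equilibrium E \<Gamma> \<alpha>"
    using si unfolding strongly_implements_def by auto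
  have \<alpha>_bids: "\<alpha> i t \<in> bids \<Gamma> i" if "i \<in> agents E" "t \<in> types E i" for i t
    using \<alpha> that unfolding equilibrium_def strategy_profile_def by auto
  have f: "f \<theta> = outcome \<Gamma> (play (agents E) \<alpha> \<theta>)" if "\<theta> \<in> type_profiles E" for \<theta>
    using si \<alpha> that unfolding strongly_implements_def by auto
  define P where "P = (\<lambda>i \<theta>. payment \<Gamma> i (play (agents E) \<alpha> \<theta>))"
  let ?D = "direct_mechanism E f P"
  have utility: "expected_utility E ?D i \<beta> s t = expected_utility E \<Gamma> i (\<lambda>j. \<alpha> j \<circ> \<beta> j) (\<alpha> i s) t"
    if "i \<in> agents E" "s \<in> types E i" "\<And>j. j \<in> agents E \<Longrightarrow> \<beta> j \<in> types E j \<rightarrow> types E j"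
    for i s \<beta> t
    unfolding P_def using that f by (intro expected_utility_direct_mechanism) auto
  have "equilibrium E ?D (\<lambda>i. id)"
    using \<alpha> \<alpha>_bids
    unfolding equilibrium_def strategy_profile_def
    by (auto simp: utility) (auto simp: direct_mechanism_def utility[unfolded direct_mechanism_def])
  moreover have "selectively_eliminable E f P \<beta>" if bad: "bad_equilibrium E f P \<beta>" for \<beta>
  proof -
    have \<beta>: "\<beta> j \<in> types E j \<rightarrow> types E j" if "j \<in> agents E" for j
      using bad that
      unfolding bad_equilibrium_def equilibrium_def strategy_profile_def direct_mechanism_def by auto
    obtain \<theta> where \<theta>: "\<theta> \<in> type_profiles E" "f (play (agents E) \<beta> \<theta>) \<noteq> f \<theta>"
      using bad unfolding bad_equilibrium_def by auto
    have "play (agents E) \<beta> \<theta> \<in> type_profiles E"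
      using \<theta> \<beta> unfolding type_profiles_def by (intro play_in_PiE) auto
    then have "outcome \<Gamma> (play (agents E) (\<lambda>j. \<alpha> j \<circ> \<beta> j) \<theta>) \<noteq> f \<theta>"
      using \<theta> f by (simp add: play_play)
    \<comment> \<open>In \<open>\<Gamma>\<close> every equilibrium yields \<open>f\<close>, whereas
      the composed profile misses it at \<open>\<theta>\<close>.\<close>
    then have "\<not> equilibrium E \<Gamma> (\<lambda>j. \<alpha> j \<circ> \<beta> j)"
      using si \<theta> unfolding strongly_implements_def by auto
    moreover have "strategy_profile E \<Gamma> (\<lambda>j. \<alpha> j \<circ> \<beta> j)"
      unfolding strategy_profile_def using \<alpha>_bids \<beta> by fastforce
    ultimately obtain i t s where i: "i \<in> agents E" and t: "t \<in> types E i" and s: "s \<in> bids \<Gamma> i"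
      and gain: "expected_utility E \<Gamma> i (\<lambda>j. \<alpha> j \<circ> \<beta> j) s t
        > expected_utility E \<Gamma> i (\<lambda>j. \<alpha> j \<circ> \<beta> j) (\<alpha> i (\<beta> i t)) t"
      unfolding equilibrium_def by (auto simp: not_le)
    \<comment> \<open>\<open>h\<close> and \<open>Q\<close> record what happens when
      \<open>i\<close> bids \<open>s\<close> and the others play \<open>\<alpha>\<close>, as
      functions of the types of the others. Fed with reports distorted by \<open>\<beta>\<close>,
      they reproduce the profitable deviation from the composed profile; fed with true types, a
      deviation from \<open>\<alpha>\<close> itself.\<close>
    define h where "h = (\<lambda>\<theta>'. outcome \<Gamma> ((play (agents E - {i}) \<alpha> \<theta>')(i := s)))"
    define Q where "Q = (\<lambda>\<theta>'. payment \<Gamma> i ((play (agents E - {i}) \<alpha> \<theta>')(i := s)))"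
    have h: "h \<in> other_types E i \<rightarrow> choices E"
    proof
      fix \<theta>' assume "\<theta>' \<in> other_types E i"
      then have "(play (agents E - {i}) \<alpha> \<theta>')(i := s) \<in> PiE (agents E) (bids \<Gamma>)"
        using i s \<alpha>_bids by (intro update_in_PiE play_in_PiE) (auto simp: other_types_def)
      then show "h \<theta>' \<in> choices E"
        using \<Gamma> unfolding h_def is_mechanism_def by auto
    qed
    have "(\<Sum>\<theta>'\<in>other_types E i. belief E i \<theta>' t *
              (valuation E i (h (play (agents E - {i}) \<beta> \<theta>')) (\<theta>'(i := t))
               + Q (play (agents E - {i}) \<beta> \<theta>')))
        = expected_utility E \<Gamma> i (\<lambda>j. \<alpha> j \<circ> \<beta> j) s t"
      unfolding expected_utility_def h_def Q_def by (simp add: play_play)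
    moreover have "(\<Sum>\<theta>'\<in>other_types E i. belief E i \<theta>' t *
              (valuation E i (f ((play (agents E - {i}) \<beta> \<theta>')(i := \<beta> i t))) (\<theta>'(i := t))
               + P i ((play (agents E - {i}) \<beta> \<theta>')(i := \<beta> i t))))
        = expected_utility E \<Gamma> i (\<lambda>j. \<alpha> j \<circ> \<beta> j) (\<alpha> i (\<beta> i t)) t"
      using utility[of i "\<beta> i t" \<beta> t] i t \<beta>
      unfolding expected_utility_def[of E ?D] by (auto simp: direct_mechanism_def)
    \<comment> \<open>The sum is the loss of type \<open>u\<close> from bidding \<open>s\<close>
      instead of \<open>\<alpha> i u\<close> while the others follow \<open>\<alpha>\<close>. It is
      nonnegative because \<open>\<alpha>\<close> is an equilibrium.\<close>
    moreover have "(\<Sum>\<theta>'\<in>other_types E i. belief E i \<theta>' u *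
              (valuation E i (f (\<theta>'(i := u))) (\<theta>'(i := u)) + P i (\<theta>'(i := u))
               - valuation E i (h \<theta>') (\<theta>'(i := u)) - Q \<theta>')) \<ge> 0" if u: "u \<in> types E i" for u
    proof -
      have "\<theta>'(i := u) \<in> type_profiles E" if "\<theta>' \<in> other_types E i" for \<theta>'
        using that i u unfolding type_profiles_def other_types_def by (intro update_in_PiE)
      moreover have "play (agents E) \<alpha> (\<theta>'(i := u)) = (play (agents E - {i}) \<alpha> \<theta>')(i := \<alpha> i u)" for \<theta>'
        using i unfolding play_def by auto
      ultimately have "(\<Sum>\<theta>'\<in>other_types E i. belief E i \<theta>' u *
              (valuation E i (f (\<theta>'(i := u))) (\<theta>'(i := u)) + P i (\<theta>'(i := u))
               - valuation E i (h \<theta>') (\<theta>'(i := u)) - Q \<theta>'))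
        = expected_utility E \<Gamma> i \<alpha> (\<alpha> i u) u - expected_utility E \<Gamma> i \<alpha> s u"
        unfolding expected_utility_def sum_subtractf[symmetric]
        by (intro sum.cong) (simp_all add: f h_def Q_def P_def algebra_simps)
      then show ?thesis
        using \<alpha> i u s unfolding equilibrium_def by simp
    qed
    ultimately show ?thesis
      unfolding selectively_eliminable_def using i t h gain
      by (intro bexI[of _ i] bexI[of _ h] exI[of _ Q] conjI bexI[of _ t] ballI) simp_all
  qed
  ultimately show ?thesis
    unfolding incentive_compatible_def selective_elimination_condition_def by blast
qed

subsection \<open>Relabelling bids\<close>

text \<open>An infinite type contains a copy of the natural numbers; a left inverse of that
  embedding followed by an enumeration of \<open>A\<close> is the required map.\<close>

lemma surj_onto_countable:
  assumes "countable A" "A \<noteq> {}"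
  shows "\<exists>d :: 's::infinite \<Rightarrow> 'm. range d = A"
proof -
  obtain e :: "nat \<Rightarrow> 's" where e: "inj e"
    using infinite_countable_subset[OF infinite_UNIV] by blast
  have "range (\<lambda>s. from_nat_into A (inv e s)) = A"
    using range_from_nat_into[OF assms(2,1)] inj_imp_surj_inv[OF e] by (metis image_image)
  then show ?thesis by blast
qed

text \<open>Every element of \<open>'s\<close> becomes a bid and is decoded by a map onto the
  original bid set. Surjectivity suffices: several codes for one bid give the same utilities, and
  every deviation in \<open>\<Gamma>\<close> has a code.\<close>

lemma strongly_implementable_relabel:
  fixes \<Gamma> :: "('m, 'x) mechanism"
  assumes \<Gamma>: "is_mechanism E \<Gamma>" and si: "strongly_implements E \<Gamma> f"
    and bids: "\<And>i. i \<in> agents E \<Longrightarrow> countable (bids \<Gamma> i) \<and> bids \<Gamma> i \<noteq> {}"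
  shows "strongly_implementable TYPE('s::infinite) E f"
proof -
  have "\<exists>d :: nat \<Rightarrow> 's \<Rightarrow> 'm. \<forall>i\<in>agents E. range (d i) = bids \<Gamma> i"
    using bids surj_onto_countable by (intro bchoice) blast
  then obtain d :: "nat \<Rightarrow> 's \<Rightarrow> 'm" where d: "\<And>i. i \<in> agents E \<Longrightarrow> range (d i) = bids \<Gamma> i"
    by blast
  define \<Gamma>' where "\<Gamma>' = \<lparr>bids = \<lambda>i. UNIV, outcome = \<lambda>s. outcome \<Gamma> (play (agents E) d s),
    payment = \<lambda>i s. payment \<Gamma> i (play (agents E) d s)\<rparr>"
  have d_bids: "d i s \<in> bids \<Gamma> i" if "i \<in> agents E" for i s
    using d[OF that] by auto
  have mech: "is_mechanism E \<Gamma>'"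
    using \<Gamma> d_bids unfolding is_mechanism_def \<Gamma>'_def play_def by (auto simp: Pi_iff)
  have utility: "expected_utility E \<Gamma>' i \<alpha> s t = expected_utility E \<Gamma> i (\<lambda>j. d j \<circ> \<alpha> j) (d i s) t"
    if "i \<in> agents E" for i \<alpha> s t
    unfolding expected_utility_def \<Gamma>'_def by (simp add: play_update[OF that])
  have equilibrium: "equilibrium E \<Gamma>' \<alpha> \<longleftrightarrow> equilibrium E \<Gamma> (\<lambda>j. d j \<circ> \<alpha> j)" for \<alpha>
    unfolding equilibrium_def strategy_profile_def
    by (auto simp: utility d_bids d[symmetric]) (auto simp: \<Gamma>'_def utility[unfolded \<Gamma>'_def])
  have "strongly_implements E \<Gamma>' f"
    unfolding strongly_implements_def
  proof (intro conjI allI impI ballI)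
    obtain \<alpha> where \<alpha>: "equilibrium E \<Gamma> \<alpha>"
      using si unfolding strongly_implements_def by auto
    \<comment> \<open>Coding and decoding restores \<open>\<alpha>\<close> only at types of agents,
      where its values are bids; hence the appeal to \<open>equilibrium_cong\<close>.\<close>
    have "d j (inv (d j) (\<alpha> j t)) = \<alpha> j t" if "j \<in> agents E" "t \<in> types E j" for j t
      using \<alpha> that d[OF that(1)] unfolding equilibrium_def strategy_profile_def
      by (intro f_inv_into_f) auto
    then have "equilibrium E \<Gamma> (\<lambda>j. d j \<circ> (inv (d j) \<circ> \<alpha> j))"
      using \<alpha> by (subst equilibrium_cong[of _ _ \<alpha>]) auto
    then show "\<exists>\<alpha>. equilibrium E \<Gamma>' \<alpha>"
      unfolding equilibrium[symmetric] by blast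
  next
    fix \<alpha> \<theta> assume "equilibrium E \<Gamma>' \<alpha>" "\<theta> \<in> type_profiles E"
    then show "outcome \<Gamma>' (play (agents E) \<alpha> \<theta>) = f \<theta>"
      using si unfolding equilibrium strongly_implements_def by (simp add: \<Gamma>'_def play_play)
  qed
  with mech show ?thesis
    unfolding strongly_implementable_def by blast
qed

subsection \<open>Sufficiency\<close>

type_synonym ('t, 'x) objection = "((nat \<Rightarrow> 't) \<Rightarrow> 'x) \<times> ((nat \<Rightarrow> 't) \<Rightarrow> rat)"

type_synonym ('t, 'x) bid = "'t + ('t, 'x) objection \<times> nat"

text \<open>The inequality is condition (2) of selective elimination. \<open>h\<close> and
  \<open>Q\<close> are extensional so that the set is countable, as relabelling requires.\<close>

definition objections ::
    "('t, 'x) environment \<Rightarrow> ((nat \<Rightarrow> 't) \<Rightarrow> 'x) \<Rightarrow> (nat \<Rightarrow> (nat \<Rightarrow> 't) \<Rightarrow> rat)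
      \<Rightarrow> nat \<Rightarrow> ('t, 'x) objection set" where
  "objections E f P i =
     {(h, Q) \<in> PiE (other_types E i) (\<lambda>_. choices E) \<times> PiE (other_types E i) (\<lambda>_. UNIV).
        \<forall>t\<in>types E i.
           (\<Sum>\<theta>'\<in>other_types E i. belief E i \<theta>' t *
              (valuation E i (f (\<theta>'(i := t))) (\<theta>'(i := t)) + P i (\<theta>'(i := t))
               - valuation E i (h \<theta>') (\<theta>'(i := t)) - Q \<theta>')) \<ge> 0}"

definition objectors :: "('t, 'x) environment \<Rightarrow> (nat \<Rightarrow> ('t, 'x) bid) \<Rightarrow> nat set" where
  "objectors E s = {j \<in> agents E. \<not> isl (s j)}"

fun fee :: "('t, 'x) bid \<Rightarrow> rat" where
  "fee (Inl _) = 0"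
| "fee (Inr (_, z)) = 1 / of_nat (Suc z)"

text \<open>When several agents object, the choice \<open>x\<close> and the payment 0 before fees
  are arbitrary. What matters is that the number \<open>z\<close> in a bid enters through the fee
  alone.\<close>

definition augmented_mechanism ::
    "('t, 'x) environment \<Rightarrow> ((nat \<Rightarrow> 't) \<Rightarrow> 'x) \<Rightarrow> (nat \<Rightarrow> (nat \<Rightarrow> 't) \<Rightarrow> rat) \<Rightarrow> 'x
      \<Rightarrow> (('t, 'x) bid, 'x) mechanism" where
  "augmented_mechanism E f P x =
     \<lparr>bids = \<lambda>i. Inl ` types E i \<union> Inr ` (objections E f P i \<times> UNIV),
      outcome = \<lambda>s.
        if objectors E s = {} then f (play (agents E) (\<lambda>_. projl) s)
        else if is_singleton (objectors E s) then
          let i = the_elem (objectors E s)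
          in fst (fst (projr (s i))) (play (agents E - {i}) (\<lambda>_. projl) s)
        else x,
      payment = \<lambda>i s.
        (if objectors E s = {} then P i (play (agents E) (\<lambda>_. projl) s)
         else if objectors E s = {i} then
           snd (fst (projr (s i))) (play (agents E - {i}) (\<lambda>_. projl) s)
         else 0) - fee (s i)\<rparr>"

text \<open>The domain \<open>other_types E i\<close> is finite, the choices are finite and the
  payments rational.\<close>

lemma countable_objections:
  assumes "bayesian_environment E"
  shows "countable (objections E f P i)"
proof -
  have "countable (PiE (other_types E i) (\<lambda>_. choices E) \<times> PiE (other_types E i) (\<lambda>_. UNIV :: rat set))"
    using assms finite_other_types[OF assms]
    unfolding bayesian_environment_def
    by (intro countable_SIGMA countable_PiE) (auto intro: countable_finite)
  then show ?thesis
    unfolding objections_def by (rule countable_subset[rotated]) auto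
qed

lemma is_mechanism_augmented:
  assumes f: "social_choice_function E f" and x: "x \<in> choices E"
  shows "is_mechanism E (augmented_mechanism E f P x)"
  unfolding is_mechanism_def
proof
  let ?\<Gamma> = "augmented_mechanism E f P x"
  fix s assume "s \<in> PiE (agents E) (bids ?\<Gamma>)"
  then have s: "s j \<in> Inl ` types E j \<union> Inr ` (objections E f P j \<times> UNIV)" if "j \<in> agents E" for j
    using that unfolding augmented_mechanism_def by (auto simp: PiE_iff)
  then have report: "projl (s j) \<in> types E j" if "j \<in> agents E" "j \<notin> objectors E s" for j
    using that unfolding objectors_def by fastforce
  show "outcome ?\<Gamma> s \<in> choices E"
  proof (cases "objectors E s = {}")
    case True
    then have "play (agents E) (\<lambda>_. projl) s \<in> type_profiles E"
      unfolding play_def type_profiles_def using report by auto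
    then show ?thesis
      using True f unfolding augmented_mechanism_def social_choice_function_def by auto
  next
    case False
    show ?thesis
    proof (cases "is_singleton (objectors E s)")
      case True
      then obtain i where i: "objectors E s = {i}"
        by (auto simp: is_singleton_def)
      then have "i \<in> agents E" "\<not> isl (s i)"
        unfolding objectors_def by auto
      then have "fst (projr (s i)) \<in> objections E f P i"
        using s by fastforce
      then have "fst (fst (projr (s i))) \<in> other_types E i \<rightarrow> choices E"
        unfolding objections_def by auto
      moreover have "play (agents E - {i}) (\<lambda>_. projl) s \<in> other_types E i"
        unfolding play_def other_types_def using report i by auto
      ultimately show ?thesis
        using i unfolding augmented_mechanism_def by auto
    next
      case False
      with \<open>objectors E s \<noteq> {}\<close> x show ?thesis
        unfolding augmented_mechanism_def by auto
    qed
  qed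
qed

text \<open>Whatever the others play, \<open>z\<close> affects only the fee of \<open>i\<close>,
  which does not depend on their types. The summand 1 is the fee at \<open>z = 0\<close>.\<close>

lemma expected_utility_fee:
  assumes "bayesian_environment E" "i \<in> agents E" "t \<in> types E i"
  shows "expected_utility E (augmented_mechanism E f P x) i \<alpha> (Inr (k, z)) t =
    expected_utility E (augmented_mechanism E f P x) i \<alpha> (Inr (k, 0)) t + 1 - fee (Inr (k, z))"
proof -
  let ?\<Gamma> = "augmented_mechanism E f P x"
  have objectors: "objectors E (s(i := Inr (k, z))) = objectors E (s(i := Inr (k, 0)))" for s
    unfolding objectors_def by auto
  have outcome: "outcome ?\<Gamma> (s(i := Inr (k, z))) = outcome ?\<Gamma> (s(i := Inr (k, 0)))" for s
  proof -
    \<comment> \<open>Agent \<open>i\<close> objects with either bid, so a sole objector is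
      \<open>i\<close>, of whose bid the outcome reads only \<open>k\<close>.\<close>
    have "the_elem (objectors E (s(i := Inr (k, 0)))) = i"
      if "is_singleton (objectors E (s(i := Inr (k, 0))))"
    proof -
      have "i \<in> objectors E (s(i := Inr (k, 0)))"
        using assms(2) unfolding objectors_def by auto
      with that show ?thesis
        by (auto simp: is_singleton_def)
    qed
    moreover have "objectors E (s(i := Inr (k, 0))) \<noteq> {}"
      using assms(2) unfolding objectors_def by auto
    moreover have "play (agents E - {i}) (\<lambda>_. projl) (s(i := Inr (k, z)))
      = play (agents E - {i}) (\<lambda>_. projl) (s(i := Inr (k, 0)))"
      unfolding play_def by auto
    ultimately show ?thesis
      unfolding augmented_mechanism_def by (simp add: objectors)
  qed
  have payment: "payment ?\<Gamma> i (s(i := Inr (k, z)))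
    = payment ?\<Gamma> i (s(i := Inr (k, 0))) + (1 - fee (Inr (k, z)))" for s
  proof -
    have "play (agents E - {i}) (\<lambda>_. projl) (s(i := Inr (k, z)))
      = play (agents E - {i}) (\<lambda>_. projl) (s(i := Inr (k, 0)))"
      unfolding play_def by auto
    moreover have "objectors E (s(i := Inr (k, 0))) \<noteq> {}"
      using assms(2) unfolding objectors_def by auto
    ultimately show ?thesis
      unfolding augmented_mechanism_def by (simp add: objectors)
  qed
  have "expected_utility E ?\<Gamma> i \<alpha> (Inr (k, z)) t = expected_utility E ?\<Gamma> i \<alpha> (Inr (k, 0)) t
      + (\<Sum>\<theta>'\<in>other_types E i. belief E i \<theta>' t * (1 - fee (Inr (k, z))))"
    unfolding expected_utility_def sum.distrib[symmetric]
    by (intro sum.cong refl) (simp only: outcome payment distrib_left add.assoc)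
  then show ?thesis
    unfolding sum_distrib_right[symmetric] sum_belief[OF assms] by simp
qed

text \<open>Without objectors there are no fees, and the augmented mechanism is the direct
  one.\<close>

lemma expected_utility_report:
  fixes E :: "('t, 'x) environment"
  assumes "i \<in> agents E"
  shows "expected_utility E (augmented_mechanism E f P x) i (\<lambda>j t. Inl (\<beta> j t)) (Inl s) t =
    expected_utility E (direct_mechanism E f P) i \<beta> s t"
proof -
  have "objectors E ((play (agents E - {i}) (\<lambda>j t. Inl (\<beta> j t) :: ('t, 'x) bid) \<theta>')(i := Inl s)) = {}" for \<theta>'
    unfolding objectors_def play_def by auto
  moreover have "play (agents E) (\<lambda>_. projl) ((play (agents E - {i}) (\<lambda>j t. Inl (\<beta> j t) :: ('t, 'x) bid) \<theta>')(i := Inl s))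
      = (play (agents E - {i}) \<beta> \<theta>')(i := s)" for \<theta>'
    unfolding play_update[OF assms] by (simp add: comp_def)
  ultimately show ?thesis
    unfolding expected_utility_def augmented_mechanism_def direct_mechanism_def by simp
qed

text \<open>When the others only report, \<open>i\<close> is the sole objector at every type
  profile, so the expected utility is the left side of condition (1) minus the fee.\<close>

lemma expected_utility_objection:
  assumes E: "bayesian_environment E" and i: "i \<in> agents E" and t: "t \<in> types E i"
  shows "expected_utility E (augmented_mechanism E f P x) i (\<lambda>j t. Inl (\<beta> j t)) (Inr ((h, Q), z)) t =
    (\<Sum>\<theta>'\<in>other_types E i. belief E i \<theta>' t *
       (valuation E i (h (play (agents E - {i}) \<beta> \<theta>')) (\<theta>'(i := t))
         + Q (play (agents E - {i}) \<beta> \<theta>'))) - 1 / of_nat (Suc z)"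
proof -
  let ?\<Gamma> = "augmented_mechanism E f P x"
  have objectors: "objectors E ((play (agents E - {i}) (\<lambda>j t. Inl (\<beta> j t)) \<theta>')(i := Inr k)) = {i}" for \<theta>' k
    unfolding objectors_def play_def using i by auto
  have reports: "play (agents E - {i}) (\<lambda>_. projl)
      ((play (agents E - {i}) (\<lambda>j t. Inl (\<beta> j t)) \<theta>')(i := k)) = play (agents E - {i}) \<beta> \<theta>'" for \<theta>' k
    unfolding play_def by auto
  have "expected_utility E ?\<Gamma> i (\<lambda>j t. Inl (\<beta> j t)) (Inr ((h, Q), z)) t =
    (\<Sum>\<theta>'\<in>other_types E i. belief E i \<theta>' t *
       (valuation E i (h (play (agents E - {i}) \<beta> \<theta>')) (\<theta>'(i := t))
         + Q (play (agents E - {i}) \<beta> \<theta>')) - belief E i \<theta>' t * (1 / of_nat (Suc z)))"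
    unfolding expected_utility_def augmented_mechanism_def
    by (intro sum.cong refl) (simp add: objectors reports ring_distribs del: of_nat_Suc)
  then show ?thesis
    unfolding sum_subtractf sum_distrib_right[symmetric] sum_belief[OF assms] by simp
qed

text \<open>Replacing \<open>z\<close> by \<open>Suc z\<close> in an objection lowers the fee and
  changes nothing else, so an objection is never a best reply.\<close>

lemma equilibrium_augmented_report:
  assumes E: "bayesian_environment E"
    and eq: "equilibrium E (augmented_mechanism E f P x) \<alpha>"
    and i: "i \<in> agents E" and t: "t \<in> types E i"
  shows "\<alpha> i t \<in> Inl ` types E i"
proof (rule ccontr)
  let ?\<Gamma> = "augmented_mechanism E f P x"
  assume "\<alpha> i t \<notin> Inl ` types E i"
  moreover have "\<alpha> i t \<in> bids ?\<Gamma> i"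
    using eq i t unfolding equilibrium_def strategy_profile_def by auto
  ultimately obtain k z where k: "k \<in> objections E f P i" "\<alpha> i t = Inr (k, z)"
    unfolding augmented_mechanism_def by auto
  then have "Inr (k, Suc z) \<in> bids ?\<Gamma> i"
    unfolding augmented_mechanism_def by auto
  then have "expected_utility E ?\<Gamma> i \<alpha> (Inr (k, Suc z)) t \<le> expected_utility E ?\<Gamma> i \<alpha> (Inr (k, z)) t"
    using eq i t k unfolding equilibrium_def by metis
  then have "(1 :: rat) / of_nat (Suc z) \<le> 1 / of_nat (Suc (Suc z))"
    unfolding expected_utility_fee[OF E i t, of f P x \<alpha> k "Suc z"]
      expected_utility_fee[OF E i t, of f P x \<alpha> k z] by simp
  then show False
    by (simp add: field_simps)
qed

text \<open>Truthful reporting is an equilibrium, by incentive compatibility against other reports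
  and by condition (2) against objections. Conversely, an equilibrium consists of reports
  \<open>\<beta>\<close> that form an equilibrium of the direct mechanism which no objection upsets;
  so \<open>\<beta>\<close> is not bad.\<close>

lemma strongly_implements_augmented:
  fixes E :: "('t, 'x) environment"
  assumes E: "bayesian_environment E"
    and ic: "incentive_compatible E f P" and sec: "selective_elimination_condition E f P"
  shows "strongly_implements E (augmented_mechanism E f P x) f"
  unfolding strongly_implements_def
proof (intro conjI allI impI)
  let ?\<Gamma> = "augmented_mechanism E f P x" and ?D = "direct_mechanism E f P"
  show "\<exists>\<alpha>. equilibrium E ?\<Gamma> \<alpha>"
  proof
    show "equilibrium E ?\<Gamma> (\<lambda>_. Inl)"
      unfolding equilibrium_def
    proof (intro conjI ballI)
      show "strategy_profile E ?\<Gamma> (\<lambda>_. Inl)"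
        unfolding strategy_profile_def augmented_mechanism_def by auto
    next
      fix i t s assume i: "i \<in> agents E" and t: "t \<in> types E i" and s: "s \<in> bids ?\<Gamma> i"
      have others: "play (agents E - {i}) (\<lambda>_. id) \<theta>' = \<theta>'" if "\<theta>' \<in> other_types E i" for \<theta>'
        using that unfolding other_types_def by (rule play_id)
      have truth: "expected_utility E ?\<Gamma> i (\<lambda>_. Inl) (Inl u) t =
        expected_utility E ?D i (\<lambda>_. id) u t" for u
        using expected_utility_report[OF i, of f P x "\<lambda>_. id" u t] by simp
      from s consider u where "u \<in> types E i" "s = Inl u"
        | h Q z where "(h, Q) \<in> objections E f P i" "s = Inr ((h, Q), z)"
        unfolding augmented_mechanism_def by auto
      then show "expected_utility E ?\<Gamma> i (\<lambda>_. Inl) s t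
        \<le> expected_utility E ?\<Gamma> i (\<lambda>_. Inl) (Inl t) t"
      proof cases
        case 1
        then show ?thesis
          using ic i t unfolding incentive_compatible_def equilibrium_def
          by (simp add: truth) (simp add: direct_mechanism_def)
      next
        case 2
        \<comment> \<open>Against truthful agents an objection does not pay even before its
          fee.\<close>
        have "0 \<le> (\<Sum>\<theta>'\<in>other_types E i. belief E i \<theta>' t *
              (valuation E i (f (\<theta>'(i := t))) (\<theta>'(i := t)) + P i (\<theta>'(i := t))
               - valuation E i (h \<theta>') (\<theta>'(i := t)) - Q \<theta>'))"
          using 2 t unfolding objections_def by auto
        also have "\<dots> = expected_utility E ?D i (\<lambda>_. id) t t
          - (\<Sum>\<theta>'\<in>other_types E i. belief E i \<theta>' t *
              (valuation E i (h \<theta>') (\<theta>'(i := t)) + Q \<theta>'))"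
          unfolding expected_utility_def sum_subtractf[symmetric]
          by (intro sum.cong) (simp_all add: direct_mechanism_def others algebra_simps)
        also have "(\<Sum>\<theta>'\<in>other_types E i. belief E i \<theta>' t *
              (valuation E i (h \<theta>') (\<theta>'(i := t)) + Q \<theta>'))
          = expected_utility E ?\<Gamma> i (\<lambda>_. Inl) s t + 1 / of_nat (Suc z)"
          unfolding 2 using expected_utility_objection[OF E i t, of f P x "\<lambda>_. id" h Q z]
          by (simp add: others del: of_nat_Suc)
        finally have "0 \<le> expected_utility E ?D i (\<lambda>_. id) t t
          - (expected_utility E ?\<Gamma> i (\<lambda>_. Inl) s t + 1 / of_nat (Suc z))" .
        moreover have "(0 :: rat) \<le> 1 / of_nat (Suc z)" by simp
        ultimately show ?thesis
          unfolding truth by linarith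
      qed
    qed
  qed
next
  let ?\<Gamma> = "augmented_mechanism E f P x" and ?D = "direct_mechanism E f P"
  fix \<alpha> assume eq: "equilibrium E ?\<Gamma> \<alpha>"
  define \<beta> where "\<beta> = (\<lambda>j t. projl (\<alpha> j t))"
  have \<alpha>: "\<alpha> j t = Inl (\<beta> j t)" "\<beta> j t \<in> types E j" if "j \<in> agents E" "t \<in> types E j" for j t
    using equilibrium_augmented_report[OF E eq that] unfolding \<beta>_def by auto
  have eq': "equilibrium E ?\<Gamma> (\<lambda>j t. Inl (\<beta> j t))"
    using eq equilibrium_cong[of E \<alpha> "\<lambda>j t. Inl (\<beta> j t)" ?\<Gamma>] \<alpha>(1) by simp
  have "equilibrium E ?D \<beta>"
    unfolding equilibrium_def
  proof (intro conjI ballI)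
    show "strategy_profile E ?D \<beta>"
      unfolding strategy_profile_def direct_mechanism_def using \<alpha>(2) by auto
  next
    fix i t s assume i: "i \<in> agents E" and t: "t \<in> types E i" and "s \<in> bids ?D i"
    then have "Inl s \<in> bids ?\<Gamma> i"
      unfolding direct_mechanism_def augmented_mechanism_def by auto
    then have "expected_utility E ?\<Gamma> i (\<lambda>j t. Inl (\<beta> j t)) (Inl s) t
      \<le> expected_utility E ?\<Gamma> i (\<lambda>j t. Inl (\<beta> j t)) (Inl (\<beta> i t)) t"
      using eq' i t unfolding equilibrium_def by auto
    then show "expected_utility E ?D i \<beta> s t \<le> expected_utility E ?D i \<beta> (\<beta> i t) t"
      unfolding expected_utility_report[OF i] .
  qed
  moreover have "\<not> selectively_eliminable E f P \<beta>"
  proof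
    assume "selectively_eliminable E f P \<beta>"
    then obtain i h Q t where i: "i \<in> agents E" and h: "h \<in> other_types E i \<rightarrow> choices E"
      and t: "t \<in> types E i"
      and gain: "(\<Sum>\<theta>'\<in>other_types E i. belief E i \<theta>' t *
              (valuation E i (h (play (agents E - {i}) \<beta> \<theta>')) (\<theta>'(i := t))
               + Q (play (agents E - {i}) \<beta> \<theta>')))
           > (\<Sum>\<theta>'\<in>other_types E i. belief E i \<theta>' t *
              (valuation E i (f ((play (agents E - {i}) \<beta> \<theta>')(i := \<beta> i t))) (\<theta>'(i := t))
               + P i ((play (agents E - {i}) \<beta> \<theta>')(i := \<beta> i t))))" (is "?H > ?F")
      and noloss: "\<forall>t\<in>types E i.
           (\<Sum>\<theta>'\<in>other_types E i. belief E i \<theta>' t *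
              (valuation E i (f (\<theta>'(i := t))) (\<theta>'(i := t)) + P i (\<theta>'(i := t))
               - valuation E i (h \<theta>') (\<theta>'(i := t)) - Q \<theta>')) \<ge> 0"
      unfolding selectively_eliminable_def by blast
    \<comment> \<open>Restriction turns the given functions into an admissible objection; it is
      harmless because \<open>\<beta>\<close> maps \<open>other_types E i\<close> into
      itself.\<close>
    let ?h = "restrict h (other_types E i)" and ?Q = "restrict Q (other_types E i)"
    have "(?h, ?Q) \<in> objections E f P i"
      unfolding objections_def using h noloss by auto
    then have bid: "Inr ((?h, ?Q), z) \<in> bids ?\<Gamma> i" for z
      unfolding augmented_mechanism_def by auto
    \<comment> \<open>\<open>z\<close> is so large that the fee stays below the gain of the
      objection.\<close>
    obtain z where z: "inverse (of_nat (Suc z)) < ?H - ?F"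
      using gain reals_Archimedean[of "?H - ?F"] by auto
    have "play (agents E - {i}) \<beta> \<theta>' \<in> other_types E i" if "\<theta>' \<in> other_types E i" for \<theta>'
      using that \<alpha>(2) unfolding other_types_def by (intro play_in_PiE) auto
    then have "expected_utility E ?\<Gamma> i (\<lambda>j t. Inl (\<beta> j t)) (Inr ((?h, ?Q), z)) t = ?H - 1 / of_nat (Suc z)"
      unfolding expected_utility_objection[OF E i t] by simp
    moreover have "expected_utility E ?\<Gamma> i (\<lambda>j t. Inl (\<beta> j t)) (Inl (\<beta> i t)) t = ?F"
      unfolding expected_utility_report[OF i] by (simp add: expected_utility_def direct_mechanism_def)
    moreover have "expected_utility E ?\<Gamma> i (\<lambda>j t. Inl (\<beta> j t)) (Inr ((?h, ?Q), z)) t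
        \<le> expected_utility E ?\<Gamma> i (\<lambda>j t. Inl (\<beta> j t)) (Inl (\<beta> i t)) t"
      using eq' i t bid unfolding equilibrium_def by auto
    ultimately show False
      using z by (simp add: inverse_eq_divide)
  qed
  ultimately have good: "f (play (agents E) \<beta> \<theta>) = f \<theta>" if "\<theta> \<in> type_profiles E" for \<theta>
    using sec that unfolding selective_elimination_condition_def bad_equilibrium_def by blast
  show "\<forall>\<theta>\<in>type_profiles E. outcome ?\<Gamma> (play (agents E) \<alpha> \<theta>) = f \<theta>"
  proof
    fix \<theta> assume \<theta>: "\<theta> \<in> type_profiles E"
    have "play (agents E) \<alpha> \<theta> = play (agents E) (\<lambda>j t. Inl (\<beta> j t)) \<theta>"
      using \<theta> \<alpha>(1) unfolding type_profiles_def by (intro play_cong) auto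
    moreover have "objectors E (play (agents E) (\<lambda>j t. Inl (\<beta> j t) :: ('t, 'x) bid) \<theta>) = {}"
      unfolding objectors_def play_def by auto
    moreover have "play (agents E) (\<lambda>_. projl) (play (agents E) (\<lambda>j t. Inl (\<beta> j t) :: ('t, 'x) bid) \<theta>) = play (agents E) \<beta> \<theta>"
      unfolding play_def by auto
    ultimately show "outcome ?\<Gamma> (play (agents E) \<alpha> \<theta>) = f \<theta>"
      using good[OF \<theta>] unfolding augmented_mechanism_def by simp
  qed
qed

theorem theorem3:
  fixes E :: "('t, 'x) environment"
    and f :: "(nat \<Rightarrow> 't) \<Rightarrow> 'x"
  assumes "bayesian_environment E"
    and "social_choice_function E f"
  shows "strongly_implementable TYPE('s::infinite) E f \<longleftrightarrow>
    (\<exists>P :: nat \<Rightarrow> (nat \<Rightarrow> 't) \<Rightarrow> rat.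
       incentive_compatible E f P \<and> selective_elimination_condition E f P)"
proof
  assume "strongly_implementable TYPE('s) E f"
  then show "\<exists>P. incentive_compatible E f P \<and> selective_elimination_condition E f P"
    unfolding strongly_implementable_def using strongly_implements_imp by blast
next
  assume "\<exists>P. incentive_compatible E f P \<and> selective_elimination_condition E f P"
  then obtain P where P: "incentive_compatible E f P" "selective_elimination_condition E f P"
    by blast
  \<comment> \<open>The prior has total mass 1, so some type profile exists, and the value of
    \<open>f\<close> there can serve as the default choice.\<close>
  obtain x where x: "x \<in> choices E"
    using type_profiles_nonempty[OF assms(1)] assms(2) unfolding social_choice_function_def by blast
  show "strongly_implementable TYPE('s) E f"
  proof (rule strongly_implementable_relabel)
    show "is_mechanism E (augmented_mechanism E f P x)"
      using assms(2) x by (rule is_mechanism_augmented)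
    show "strongly_implements E (augmented_mechanism E f P x) f"
      using assms(1) P by (rule strongly_implements_augmented)
    \<comment> \<open>Countability is needed for the bid sets only: the type
      \<open>('t, 'x) bid\<close> itself may be uncountable.\<close>
    fix i assume i: "i \<in> agents E"
    then have "countable (types E i)"
      using assms(1) unfolding bayesian_environment_def by (auto intro: countable_finite)
    then show "countable (bids (augmented_mechanism E f P x) i) \<and> bids (augmented_mechanism E f P x) i \<noteq> {}"
      using countable_objections[OF assms(1)] types_nonempty[OF assms(1) i]
      unfolding augmented_mechanism_def by auto
  qed
qed

end
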